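(* Let $S$ be a numerical semigroup and let $I,I'$ be proper maximum sparse ideals of $S$ with leaders $\lambda_i,\lambda_{i'}$ respectively. The following are equivalent: (1) $I'\supseteq I$; (2) $\lambda_i-\lambda_{i'}\in S$; (3) $S\setminus I'\subseteq S\setminus I$; (4) $\#(S\setminus I)-\#(S\setminus I')\in S$.
   Context: A numerical semigroup $S$ is a subset of $\mathbb{N}_0$ containing $0$, closed under addition, with finite complement. Its elements in increasing order are $\lambda_0=0<\lambda_1<\lambda_2<\cdots$; the genus is $g=\#(\mathbb{N}_0\setminus S)$. An ideal of $S$ is a subset $I\subseteq S$ with $I+S\subseteq I$; it is proper if $I\neq S$. The Frobenius number of an ideal $I$ is the largest integer not in $I$. It is known that it is at most $2g-1+\#(S\setminus I)$; ideals attaining this bound are called maximum sparse. For $i\ge 0$ let $D(i)=\{\lambda_j\in S:\lambda_i-\lambda_j\in S\}$ and let $G(i)$ be the number of pairs of gaps (elements of $\mathbb{N}_0\setminus S$) adding up to $\lambda_i$. It is known that a proper ideal $I$ is maximum sparse if and only if $I=S\setminus D(i)$ for some $i$ with $G(i)=0$; in this case $\lambda_i$ is called the leader of $I$. *)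

theory Defs
  imports "HOL-Library.Infinite_Set"
begin

definition numerical_semigroup :: "nat set \<Rightarrow> bool" where
  "numerical_semigroup S \<longleftrightarrow> 0 \<in> S \<and> (\<forall>x\<in>S. \<forall>y\<in>S. x + y \<in> S) \<and> finite (- S)"

abbreviation gaps :: "nat set \<Rightarrow> nat set" where
  "gaps S \<equiv> - S"

definition genus :: "nat set \<Rightarrow> nat" where
  "genus S = card (gaps S)"

definition semigroup_elem :: "nat set \<Rightarrow> nat \<Rightarrow> nat" where
  "semigroup_elem S i = enumerate S i"

definition semigroup_ideal :: "nat set \<Rightarrow> nat set \<Rightarrow> bool" where
  "semigroup_ideal S I \<longleftrightarrow> I \<subseteq> S \<and> (\<forall>x\<in>I. \<forall>s\<in>S. x + s \<in> I)"

definition proper_ideal :: "nat set \<Rightarrow> nat set \<Rightarrow> bool" where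
  "proper_ideal S I \<longleftrightarrow> semigroup_ideal S I \<and> I \<noteq> S"

text \<open>
  The largest integer outside \<open>I\<close> need not exist (for \<open>I = {}\<close>) and may be negative
  (it is \<open>-1\<close> for \<open>I = UNIV\<close>), hence a relation with values in the integers.
\<close>
definition is_frobenius_number :: "nat set \<Rightarrow> int \<Rightarrow> bool" where
  "is_frobenius_number I f \<longleftrightarrow> f \<notin> int ` I \<and> (\<forall>n. n \<notin> int ` I \<longrightarrow> n \<le> f)"

definition maximum_sparse :: "nat set \<Rightarrow> nat set \<Rightarrow> bool" where
  "maximum_sparse S I \<longleftrightarrow> semigroup_ideal S I \<and>
     is_frobenius_number I (2 * int (genus S) - 1 + int (card (S - I)))"

definition divisors :: "nat set \<Rightarrow> nat \<Rightarrow> nat set" where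
  "divisors S i = {x \<in> S. int (semigroup_elem S i) - int x \<in> int ` S}"

text \<open>The pairs of gaps are ordered.\<close>
definition gap_pairs :: "nat set \<Rightarrow> nat \<Rightarrow> nat" where
  "gap_pairs S i = card {(a, b). a \<in> gaps S \<and> b \<in> gaps S \<and> a + b = semigroup_elem S i}"

text \<open>
  Meant for proper maximum sparse ideals \<open>I\<close> only. The right-hand side does not by itself
  imply maximum sparseness: \<open>i = 0\<close> and \<open>I = S - {0}\<close> satisfy it for every \<open>S\<close>, but
  \<open>S - {0}\<close> is maximum sparse only if \<open>S = UNIV\<close>.
\<close>
definition is_leader :: "nat set \<Rightarrow> nat set \<Rightarrow> nat \<Rightarrow> bool" where
  "is_leader S I l \<longleftrightarrow>
     (\<exists>i. l = semigroup_elem S i \<and> gap_pairs S i = 0 \<and> I = S - divisors S i)"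

end

theory Submission
  imports Defs
begin

text \<open>
  The Frobenius number of a maximum sparse ideal \<open>I = S - D(i)\<close> is its leader: it is at least the
  leader because the leader lies in \<open>D(i)\<close>, and a number outside \<open>I\<close> beyond the leader would be
  a gap of \<open>S\<close>, whereas the value \<open>2g - 1 + #(S - I)\<close> exceeds every gap. Hence
  \<open>#(S - I)\<close> is the leader minus \<open>2g - 1\<close>, and differences of these cardinalities are
  differences of leaders. Inclusion of the sets \<open>D(i)\<close> is divisibility of leaders in \<open>S\<close>.
\<close>

text \<open>Two elements of \<open>S\<close> cannot add up to the gap \<open>x\<close>, so
  subtraction from \<open>x\<close> maps the elements of \<open>S\<close> in \<open>{..x}\<close>
  injectively into the gaps. Hence each of the two parts of \<open>{..x}\<close>, inside and outside
  \<open>S\<close>, has at most \<open>genus S\<close> elements, while \<open>{..x}\<close> has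
  \<open>x + 1\<close>.\<close>

lemma gap_less_twice_genus:
  assumes S: "numerical_semigroup S" and x: "x \<in> gaps S"
  shows "x < 2 * genus S"
proof -
  have fin: "finite (gaps S)" and add: "\<And>a b. a \<in> S \<Longrightarrow> b \<in> S \<Longrightarrow> a + b \<in> S"
    using S by (auto simp: numerical_semigroup_def)
  have gap: "x - a \<in> gaps S" if "a \<in> S" "a \<le> x" for a
    using add[of a "x - a"] that x by auto
  have "card ({..x} \<inter> S) \<le> genus S"
    unfolding genus_def
    by (rule card_inj_on_le[where f = "\<lambda>a. x - a"]) (use gap fin in \<open>auto simp: inj_on_def\<close>)
  moreover have "card ({..x} - S) \<le> genus S"
    unfolding genus_def by (rule card_mono) (use fin in auto)
  moreover have "card {..x} = card ({..x} \<inter> S) + card ({..x} - S)"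
    by (rule card_Int_Diff) simp
  ultimately show ?thesis by simp
qed

text \<open>As 0 is in \<open>S\<close>, the element with index \<open>i'\<close> divides itself, so
  the inclusion makes it a divisor of the element with index \<open>i\<close>. Conversely,
  divisibility is transitive because the cofactors add up inside \<open>S\<close>.\<close>

lemma divisors_subset_iff:
  assumes S: "numerical_semigroup S"
  shows "divisors S i' \<subseteq> divisors S i \<longleftrightarrow>
    int (semigroup_elem S i) - int (semigroup_elem S i') \<in> int ` S" (is "_ \<longleftrightarrow> ?d \<in> _")
proof
  have zero: "0 \<in> S" and inf: "infinite S"
    using S by (auto simp: numerical_semigroup_def dest: finite_compl)
  have "semigroup_elem S i' \<in> divisors S i'"
    using zero inf by (auto simp: divisors_def semigroup_elem_def enumerate_in_set)
  then show "?d \<in> int ` S" if "divisors S i' \<subseteq> divisors S i"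
    using that by (auto simp: divisors_def)
next
  assume "?d \<in> int ` S"
  then obtain s where s: "s \<in> S" "?d = int s" by auto
  show "divisors S i' \<subseteq> divisors S i"
  proof
    fix x assume "x \<in> divisors S i'"
    then obtain t where t: "x \<in> S" "t \<in> S" "int (semigroup_elem S i') - int x = int t"
      by (auto simp: divisors_def)
    have "int (semigroup_elem S i) - int x = int (s + t)" "s + t \<in> S"
      using S s t by (auto simp: numerical_semigroup_def)
    then show "x \<in> divisors S i" using t(1) by (simp add: divisors_def del: of_nat_add)
  qed
qed

lemma leader_maximum_sparse:
  assumes S: "numerical_semigroup S" and I: "maximum_sparse S I" and l: "is_leader S I l"
  shows "int l = 2 * int (genus S) - 1 + int (card (S - I))"
proof -
  obtain i where i: "l = semigroup_elem S i" "I = S - divisors S i"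
    using l by (auto simp: is_leader_def)
  have zero: "0 \<in> S" and inf: "infinite S"
    using S by (auto simp: numerical_semigroup_def dest: finite_compl)
  have D: "S - I = divisors S i" using i(2) by (auto simp: divisors_def)
  have lD: "l \<in> divisors S i"
    using zero inf by (auto simp: i divisors_def semigroup_elem_def enumerate_in_set)
  have bound: "x \<le> l" if "x \<in> divisors S i" for x
    using that by (auto simp: divisors_def i)
  \<comment> \<open>An infinite set would have \<open>card\<close> equal to 0; finiteness gives a
    positive cardinality, which lifts \<open>f\<close> below to at least
    \<open>2 * genus S\<close>.\<close>
  have "finite (divisors S i)"
    by (rule finite_subset[of _ "{..l}"]) (use bound in auto)
  then have pos: "card (S - I) > 0" using lD D by (auto simp: card_gt_0_iff)
  define f where "f = 2 * int (genus S) - 1 + int (card (S - I))"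
  have f: "f \<notin> int ` I" and max: "\<And>n. n \<notin> int ` I \<Longrightarrow> n \<le> f"
    using I by (auto simp: maximum_sparse_def is_frobenius_number_def f_def)
  have "int l \<le> f" by (rule max) (use lD i(2) in auto)
  then obtain m where m: "f = int m" by (metis nonneg_int_cases of_nat_0_le_iff order_trans)
  \<comment> \<open>A gap would be smaller than \<open>2 * genus S\<close>, but \<open>pos\<close>
    makes \<open>m\<close> at least that large.\<close>
  have "m \<in> S" using gap_less_twice_genus[OF S, of m] pos m by (auto simp: f_def)
  then have "m \<in> divisors S i" using f m i(2) by auto
  then show ?thesis using bound[of m] \<open>int l \<le> f\<close> m by (simp add: f_def)
qed

theorem theorem1:
  fixes S I I' :: "nat set" and i i' :: nat
  assumes "numerical_semigroup S"
    and "proper_ideal S I" and "maximum_sparse S I" and "is_leader S I (semigroup_elem S i)"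
    and "proper_ideal S I'" and "maximum_sparse S I'" and "is_leader S I' (semigroup_elem S i')"
  shows "(I' \<supseteq> I \<longleftrightarrow> int (semigroup_elem S i) - int (semigroup_elem S i') \<in> int ` S) \<and>
         (I' \<supseteq> I \<longleftrightarrow> S - I' \<subseteq> S - I) \<and>
         (I' \<supseteq> I \<longleftrightarrow> int (card (S - I)) - int (card (S - I')) \<in> int ` S)"
proof -
  \<comment> \<open>The index hidden in \<open>is_leader\<close> can be replaced by the given one,
    since \<open>divisors\<close> depends on the index only through the semigroup element.\<close>
  have "I = S - divisors S i" "I' = S - divisors S i'"
    using assms(4,7) by (auto simp: is_leader_def divisors_def)
  then have "I' \<supseteq> I \<longleftrightarrow> divisors S i' \<subseteq> divisors S i" "I' \<supseteq> I \<longleftrightarrow> S - I' \<subseteq> S - I"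
    by (auto simp: divisors_def)
  moreover have "int (card (S - I)) - int (card (S - I')) =
      int (semigroup_elem S i) - int (semigroup_elem S i')"
    using leader_maximum_sparse[OF assms(1,3,4)] leader_maximum_sparse[OF assms(1,6,7)] by simp
  ultimately show ?thesis using divisors_subset_iff[OF assms(1)] by simp
qed

end
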